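(* Let $g:\mathbb{N}\to\mathbb{R}_{>0}$ be any function with $g(n)\to\infty$ and $g(n)=o(n)$ as $n\to\infty$. Fix $b\in(1,2)$ and let $n\to\infty$ over $\mathbb{N}_b:=\bigcup_{j\ge0}\{n: 2^j b<n\le 2^{j+1}\}$. Then, with probability tending to $1$ as $n\to\infty$, the number of calls to the insertion function needed to build, starting from an empty table, the \textsc{Lua} table obtained by inserting the keys $\pi(1),\dots,\pi(n)$ in this order, where $\pi$ is a uniformly random permutation of $[n]$, is $O(n\,g(n))$.
   Context: \textbf{\textsc{Lua} hybrid table.} A table has an array-part, whose range of keys is $[1,2^a]$ for some $a\ge 0$ (or empty initially), and a hash-part, which is a \textsc{Lua} hashmap of size a power of two. When a key/value pair is inserted: if the key is a positive integer inside the current range of the array-part, the value is stored there. Otherwise the pair is inserted into the hash-part: placed at its hashed slot if that slot is free, otherwise into a free slot found by a downward scan with a pointer that only decreases; if no free slot exists, a rehash is triggered. At a rehash, one computes the largest $a'\ge0$ such that $[1,2^{a'}]$ contains at least $2^{a'-1}+1$ keys of the table; the new array-part has range $[1,2^{a'}]$ and receives the values of the keys in that range; all other keys are reinserted (via the insertion function) into a new hash-part of size $2^{m}$, where $m$ is chosen so that the number of elements it contains lies in $(2^{m-1},2^m]$. The number of calls to the insertion function counts one call per insertion plus one call per key reinserted into the hash-part during rehashes (equivalently, up to constants, $n+\sum_i\beta_i$ with $\beta_i$ the hash-part size after the $i$-th rehash). *)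

theory Defs
  imports
    "HOL-Probability.Probability"
    "HOL-Library.Landau_Symbols"
    "HOL-Combinatorics.Permutations"
begin

text \<open>
  Keys are natural numbers. Cell \<open>i\<close> of \<open>array_part\<close> holds the value of the key \<open>i + 1\<close>, so the
  range of the array-part is \<open>{1..length array_part}\<close>. The hash-part is the list \<open>slots\<close>; all slots
  from position \<open>free_ptr\<close> upwards have already been passed by the downward scan.
\<close>

record 'v lua_table =
  array_part :: "'v option list"
  slots :: "(nat \<times> 'v) option list"
  free_ptr :: nat

definition empty_table :: "'v lua_table" where
  "empty_table = \<lparr>array_part = [], slots = [], free_ptr = 0\<rparr>"

definition array_range :: "'v lua_table \<Rightarrow> nat set" where
  "array_range t = {1..length (array_part t)}"

text \<open>Downward scan for a free slot, starting just below the given pointer.\<close>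

fun scan_down :: "'e option list \<Rightarrow> nat \<Rightarrow> nat option" where
  "scan_down s 0 = None"
| "scan_down s (Suc p) = (if s ! p = None then Some p else scan_down s p)"

text \<open>
  Storing a pair whose key is not yet in the hash-part; the result is \<open>None\<close> if there is no free slot.
  The argument \<open>h\<close> maps the size of the hash-part and a key to the hashed slot of that key.
\<close>

definition store :: "(nat \<Rightarrow> nat \<Rightarrow> nat) \<Rightarrow> nat \<times> 'v \<Rightarrow> 'v lua_table \<Rightarrow> 'v lua_table option" where
  "store h kv t =
    (let k = fst kv; s = slots t; i = h (length s) k in
     if k \<in> array_range t then
       Some (t\<lparr>array_part := (array_part t)[k - 1 := Some (snd kv)]\<rparr>)
     else if s \<noteq> [] \<and> s ! i = None then
       Some (t\<lparr>slots := s[i := Some kv]\<rparr>)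
     else
       (case scan_down s (free_ptr t) of
          None \<Rightarrow> None
        | Some p \<Rightarrow> Some (t\<lparr>slots := s[p := Some kv], free_ptr := p\<rparr>)))"

definition array_entries :: "'v lua_table \<Rightarrow> (nat \<times> 'v) list" where
  "array_entries t =
    [(Suc i, the (array_part t ! i)). i \<leftarrow> [0..<length (array_part t)], array_part t ! i \<noteq> None]"

definition hash_entries :: "'v lua_table \<Rightarrow> (nat \<times> 'v) list" where
  "hash_entries t = [the e. e \<leftarrow> rev (slots t), e \<noteq> None]"

text \<open>
  More than half of the keys in \<open>[1, 2 ^ a]\<close> belong to \<open>K\<close>. The bound is \<open>2 ^ (a - 1) + 1\<close> for
  \<open>a \<ge> 1\<close> and \<open>1\<close> for \<open>a = 0\<close>.
\<close>

definition majority :: "nat set \<Rightarrow> nat \<Rightarrow> bool" where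
  "majority K a \<longleftrightarrow> card (K \<inter> {1..2 ^ a}) \<ge> 2 ^ a div 2 + 1"

definition new_array_size :: "nat set \<Rightarrow> nat" where
  "new_array_size K = (if \<exists>a. majority K a then 2 ^ (GREATEST a. majority K a) else 0)"

text \<open>
  The condition on \<open>m\<close> says that \<open>r\<close> lies in the interval \<open>(2 ^ (m - 1), 2 ^ m]\<close>, with
  \<open>2 ^ (m - 1) = 1/2\<close> if \<open>m = 0\<close>. A hash-part without elements has no slots.
\<close>

definition new_hash_size :: "nat \<Rightarrow> nat" where
  "new_hash_size r = (if r = 0 then 0 else 2 ^ (THE m. 2 ^ m < 2 * r \<and> r \<le> 2 ^ m))"

text \<open>
  Rehash triggered by the pair \<open>kv\<close>, which takes part in the computation of the new sizes. The second
  component is the number of keys reinserted into the hash-part. The new hash-part has room for all of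
  them, so that \<open>store\<close> does not fail here.
\<close>

definition rehash :: "(nat \<Rightarrow> nat \<Rightarrow> nat) \<Rightarrow> nat \<times> 'v \<Rightarrow> 'v lua_table \<Rightarrow> 'v lua_table \<times> nat" where
  "rehash h kv t =
    (let es = array_entries t @ hash_entries t @ [kv];
         N = new_array_size (fst ` set es);
         rest = filter (\<lambda>e. fst e \<notin> {1..N}) es;
         M = new_hash_size (length rest);
         t0 = \<lparr>array_part = map (\<lambda>i. map_of es (Suc i)) [0..<N],
               slots = replicate M None, free_ptr = M\<rparr>
     in (fold (\<lambda>e u. the (store h e u)) rest t0, length rest))"

text \<open>The second component of the state counts the calls to the insertion function.\<close>

definition insert_pair ::
    "(nat \<Rightarrow> nat \<Rightarrow> nat) \<Rightarrow> nat \<times> 'v \<Rightarrow> 'v lua_table \<times> nat \<Rightarrow> 'v lua_table \<times> nat" where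
  "insert_pair h kv tc =
    (case store h kv (fst tc) of
       Some t' \<Rightarrow> (t', snd tc + 1)
     | None \<Rightarrow> (let (t', r) = rehash h kv (fst tc) in (t', snd tc + 1 + r)))"

definition insertion_calls :: "(nat \<Rightarrow> nat \<Rightarrow> nat) \<Rightarrow> (nat \<times> 'v) list \<Rightarrow> nat" where
  "insertion_calls h kvs = snd (fold (insert_pair h) kvs (empty_table, 0))"

definition N_set :: "real \<Rightarrow> nat set" where
  "N_set b = (\<Union>j. {n. 2 ^ j * b < real n \<and> n \<le> 2 ^ (j + 1)})"

end

theory Submission
  imports Defs
begin

text \<open>
  A rehash happens only when the hash-part is full, and the array-part never shrinks. A rehash that keeps
  the array-part doubles the hash-part, so the costs of consecutive such rehashes form a geometric
  sum, and it suffices to show that the array-part is enlarged only \<open>O(g n)\<close> times, at cost at most \<open>n\<close>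
  each. Let \<open>2 ^ j * b < n \<le> 2 ^ (j + 1)\<close> and \<open>T = (1 / 2 - \<epsilon>) * n\<close> with \<open>\<epsilon>\<close> small in terms of \<open>b\<close>.

  Among the first \<open>T\<close> keys the expected share of \<open>{1..2 ^ a}\<close> is bounded away from one half, so by
  Chebyshev's inequality a majority in \<open>{1..2 ^ a}\<close> for some \<open>a > g n\<close> has probability
  \<open>O(2 powr - g n)\<close>, and up to time \<open>T\<close> the array-part takes at most \<open>g n + 2\<close> different sizes.
  After time \<open>T\<close>, a full hash-part next to an array-part of size at most \<open>n / 2 ^ d\<close> has more than
  \<open>2 ^ (j - 1)\<close> slots because \<open>b > 1\<close>, hence at least \<open>2 ^ j\<close>; the next rehash then sees more than
  \<open>2 ^ j\<close> keys and moves everything into the array-part. So after time \<open>T\<close> only the boundedly many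
  array sizes above \<open>n / 2 ^ d\<close> are added.
\<close>

subsection \<open>Tables and rehashes\<close>

lemma majority_mono:
  assumes "majority K a" "K \<subseteq> L"
  shows "majority L a"
proof -
  have "card (K \<inter> {1..2 ^ a}) \<le> card (L \<inter> {1..2 ^ a})"
    using assms(2) by (intro card_mono) auto
  then show ?thesis using assms(1) by (simp add: majority_def)
qed

lemma majority_imp_less:
  assumes "finite K" "majority K a"
  shows "2 ^ a < 2 * card K"
proof -
  have "card (K \<inter> {1..2 ^ a}) \<le> card K"
    using assms(1) by (intro card_mono) auto
  then show ?thesis using assms(2) by (simp add: majority_def)
qed

text \<open>A crude bound: it keeps the set of majority exponents finite, so that
  \<open>GREATEST\<close> is meaningful and the later union bound has finitely many terms.\<close>

lemma majority_le_card:
  assumes "finite K" "majority K a"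
  shows "a \<le> 2 * card K"
  using majority_imp_less[OF assms] less_exp[of a] by linarith

lemma new_array_size_cases:
  assumes "finite K"
  obtains "new_array_size K = 0"
  | a where "new_array_size K = 2 ^ a" "majority K a"
proof (cases "\<exists>a. majority K a")
  case True
  then have "majority K (GREATEST a. majority K a)"
    by (rule GreatestI_ex_nat) (use majority_le_card[OF assms] in blast)
  then show ?thesis using that True by (simp add: new_array_size_def)
qed (use that in \<open>simp add: new_array_size_def\<close>)

lemma new_array_size_ge:
  assumes "finite K" "majority K a"
  shows "2 ^ a \<le> new_array_size K"
proof -
  have "a \<le> (GREATEST a. majority K a)"
    using assms by (intro Greatest_le_nat[where b = "2 * card K"] majority_le_card)
  then show ?thesis using assms(2) by (auto simp: new_array_size_def)
qed

text \<open>The least \<open>m\<close> with \<open>r \<le> 2 ^ m\<close> meets both conditions, and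
  two exponents meeting them differ by less than 1, so \<open>THE\<close> is justified.\<close>

lemma new_hash_size_pow2:
  assumes "r > 0"
  shows "\<exists>m. new_hash_size r = 2 ^ m \<and> 2 ^ m < 2 * r \<and> r \<le> 2 ^ m"
proof -
  let ?P = "\<lambda>m. 2 ^ m < 2 * r \<and> r \<le> 2 ^ m"
  define m where "m = (LEAST m. r \<le> 2 ^ m)"
  have ge: "r \<le> 2 ^ m"
    unfolding m_def by (rule LeastI[of _ r]) (rule less_imp_le[OF less_exp])
  have "2 ^ m < 2 * r"
  proof (cases m)
    case (Suc l)
    then have "\<not> r \<le> 2 ^ l" using not_less_Least[of l "\<lambda>m. r \<le> 2 ^ m"] by (simp add: m_def)
    then show ?thesis using Suc by simp
  qed (use assms in simp)
  moreover have "x = m" if "?P x" for x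
  proof -
    have "(2::nat) ^ x < 2 ^ Suc m" "(2::nat) ^ m < 2 ^ Suc x" using that ge \<open>2 ^ m < 2 * r\<close> by simp_all
    then have "x < Suc m" "m < Suc x"
      using power_less_imp_less_exp[of "2::nat" x "Suc m"] power_less_imp_less_exp[of "2::nat" m "Suc x"]
      by simp_all
    then show ?thesis by simp
  qed
  ultimately have "(THE m. ?P m) = m" using ge by (intro the_equality conjI)
  then have "new_hash_size r = 2 ^ m" using assms by (simp add: new_hash_size_def)
  then show ?thesis using ge \<open>2 ^ m < 2 * r\<close> by blast
qed

lemma new_hash_size_ge: "r \<le> new_hash_size r"
  using new_hash_size_pow2[of r] by (cases "r = 0") (simp, metis gr0I)

lemma new_hash_size_le: "new_hash_size r \<le> 2 * r"
  using new_hash_size_pow2[of r] by (cases "r = 0") (simp add: new_hash_size_def, metis gr0I less_imp_le)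

section \<open>Free slots, and tables that represent a key set\<close>

lemma scan_down_None: "scan_down s p = None \<Longrightarrow> i < p \<Longrightarrow> s ! i \<noteq> None"
  by (induction p) (auto split: if_splits simp: less_Suc_eq)

lemma scan_down_Some:
  "scan_down s p = Some q \<Longrightarrow> q < p \<and> s ! q = None \<and> (\<forall>i. q < i \<and> i < p \<longrightarrow> s ! i \<noteq> None)"
  by (induction p) (auto split: if_splits simp: less_Suc_eq)

lemma mset_hash_entries:
  fixes t :: "'v lua_table"
  shows "mset (hash_entries t) = image_mset the (filter_mset (\<lambda>e. e \<noteq> None) (mset (slots t)))"
proof -
  have "[the e. e \<leftarrow> xs, e \<noteq> None] = map the (filter (\<lambda>e. e \<noteq> None) xs)"
    for xs :: "(nat \<times> 'v) option list"
    by (induction xs) auto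
  then show ?thesis by (simp only: hash_entries_def mset_map mset_filter mset_rev)
qed

text \<open>Values are forgotten, since keys alone decide when a rehash happens and what it costs.
  The multiset equation puts each key outside the array range into exactly one slot. By the last
  clause a scan from \<open>free_ptr\<close> misses no free slot.\<close>

definition represents :: "nat set \<Rightarrow> 'v lua_table \<Rightarrow> bool" where
  "represents K t \<longleftrightarrow> finite K \<and> 0 \<notin> K \<and>
    (\<forall>i < length (array_part t). array_part t ! i \<noteq> None \<longleftrightarrow> Suc i \<in> K) \<and>
    image_mset fst (mset (hash_entries t)) = mset_set (K - array_range t) \<and>
    (length (slots t) = 0 \<or> (\<exists>m. length (slots t) = 2 ^ m)) \<and>
    free_ptr t \<le> length (slots t) \<and>
    (\<forall>p. free_ptr t \<le> p \<and> p < length (slots t) \<longrightarrow> slots t ! p \<noteq> None)"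

lemma represents_length:
  assumes "represents K t"
  shows "card (K - array_range t) = length (filter (\<lambda>e. e \<noteq> None) (slots t))"
proof -
  have "card (K - array_range t) = size (image_mset fst (mset (hash_entries t)))"
    using assms by (simp add: represents_def)
  then show ?thesis by (simp add: mset_hash_entries flip: mset_filter)
qed

lemma represents_full:
  assumes "represents K t"
  shows "card (K - array_range t) = length (slots t) \<longleftrightarrow> (\<forall>p < length (slots t). slots t ! p \<noteq> None)"
proof -
  have "length (filter (\<lambda>e. e \<noteq> None) (slots t)) = length (slots t) \<longleftrightarrow>
      length (filter (\<lambda>e. \<not> e \<noteq> None) (slots t)) = 0"
    using sum_length_filter_compl[of "\<lambda>e. e \<noteq> None" "slots t"] by arith
  also have "\<dots> \<longleftrightarrow> (\<forall>e \<in> set (slots t). e \<noteq> None)"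
    by (simp only: length_0_conv filter_empty_conv not_not)
  finally have "length (filter (\<lambda>e. e \<noteq> None) (slots t)) = length (slots t) \<longleftrightarrow>
      (\<forall>e \<in> set (slots t). e \<noteq> None)" .
  then show ?thesis
    unfolding represents_length[OF assms] all_set_conv_all_nth .
qed

lemma represents_card_le:
  assumes "represents K t"
  shows "card (K - array_range t) \<le> length (slots t)"
  unfolding represents_length[OF assms] by simp

text \<open>Covers both placements: at the hashed slot \<open>p\<close> is the old pointer, after a
  scan \<open>p\<close> is the slot \<open>i\<close> that was found.\<close>

lemma represents_slot_update:
  assumes "represents K t" "fst kv \<notin> K" "fst kv > 0" "fst kv \<notin> array_range t"
    and "i < length (slots t)" "slots t ! i = None"
    and "p \<le> free_ptr t" "\<And>q. p \<le> q \<Longrightarrow> q < free_ptr t \<Longrightarrow> q \<noteq> i \<Longrightarrow> slots t ! q \<noteq> None"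
  shows "represents (insert (fst kv) K) (t\<lparr>slots := (slots t)[i := Some kv], free_ptr := p\<rparr>)"
proof -
  have "mset (hash_entries (t\<lparr>slots := (slots t)[i := Some kv], free_ptr := p\<rparr>)) =
      add_mset kv (mset (hash_entries t))"
    using assms(5,6) by (simp add: mset_hash_entries mset_update)
  moreover have "insert (fst kv) K - array_range t = insert (fst kv) (K - array_range t)"
    using assms(4) by auto
  ultimately have "image_mset fst (mset (hash_entries (t\<lparr>slots := (slots t)[i := Some kv], free_ptr := p\<rparr>))) =
      mset_set (insert (fst kv) K - array_range t)"
    using assms(1,2) by (simp add: represents_def)
  moreover have "Suc i' \<noteq> fst kv" if "i' < length (array_part t)" for i'
    using that assms(3,4) by (auto simp: array_range_def)
  ultimately show ?thesis
    using assms by (auto simp: represents_def array_range_def nth_list_update) 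
      (metis linorder_not_le option.simps(3))+
qed

text \<open>If the hash-part has room, some slot is free; it lies below \<open>free_ptr\<close>,
  because all slots from there on are occupied, so the scan succeeds.\<close>

lemma store_Some:
  assumes h: "\<And>m k. h (2 ^ m) k < 2 ^ m"
    and rep: "represents K t" and kv: "fst kv \<notin> K" "fst kv > 0"
    and room: "fst kv \<in> array_range t \<or> card (K - array_range t) < length (slots t)"
  obtains t' where "store h kv t = Some t'" "represents (insert (fst kv) K) t'"
    "length (array_part t') = length (array_part t)" "length (slots t') = length (slots t)"
proof -
  let ?k = "fst kv" and ?i = "h (length (slots t)) (fst kv)"
  consider "?k \<in> array_range t"
    | "?k \<notin> array_range t" "slots t \<noteq> []" "slots t ! ?i = None"
    | "?k \<notin> array_range t" "\<not> (slots t \<noteq> [] \<and> slots t ! ?i = None)"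
    by metis
  then show ?thesis
  proof cases
    case 1
    let ?t = "t\<lparr>array_part := (array_part t)[?k - 1 := Some (snd kv)]\<rparr>"
    have "insert ?k K - array_range t = K - array_range t" using 1 by auto
    then have "represents (insert ?k K) ?t"
      using rep kv 1
      by (auto simp: represents_def array_range_def nth_list_update mset_hash_entries)
    moreover have "store h kv t = Some ?t" using 1 by (simp add: store_def Let_def)
    ultimately show ?thesis using that by simp
  next
    case 2
    let ?t = "t\<lparr>slots := (slots t)[?i := Some kv]\<rparr>"
    have "?i < length (slots t)" using 2 h rep by (auto simp: represents_def)
    then have "represents (insert ?k K) (t\<lparr>slots := (slots t)[?i := Some kv], free_ptr := free_ptr t\<rparr>)"
      using 2 rep kv by (intro represents_slot_update) auto
    moreover have "store h kv t = Some ?t" using 2 by (simp add: store_def Let_def)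
    ultimately show ?thesis using that by simp
  next
    case 3
    have "card (K - array_range t) \<noteq> length (slots t)" using room 3 by auto
    then obtain p where p: "p < length (slots t)" "slots t ! p = None"
      using represents_full[OF rep] by metis
    then have "p < free_ptr t" using rep by (auto simp: represents_def not_le[symmetric])
    then obtain q where q: "scan_down (slots t) (free_ptr t) = Some q"
      using p(2) scan_down_None by (metis not_None_eq)
    let ?t = "t\<lparr>slots := (slots t)[q := Some kv], free_ptr := q\<rparr>"
    have "q < length (slots t)" using scan_down_Some[OF q] rep by (auto simp: represents_def)
    then have "represents (insert ?k K) ?t"
      using 3 rep kv scan_down_Some[OF q] by (intro represents_slot_update) auto
    moreover have "store h kv t = Some ?t" using 3 q by (auto simp: store_def Let_def)
    ultimately show ?thesis using that by simp
  qed
qed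

text \<open>Together with \<open>store_Some\<close>: a rehash happens exactly when the new key is
  outside the array range and the hash-part is full.\<close>

lemma store_None:
  assumes h: "\<And>m k. h (2 ^ m) k < 2 ^ m"
    and rep: "represents K t" and k: "fst kv \<notin> array_range t"
    and full: "card (K - array_range t) = length (slots t)"
  shows "store h kv t = None"
proof -
  have full': "\<forall>p < length (slots t). slots t ! p \<noteq> None"
    using represents_full[OF rep] full by blast
  have "slots t \<noteq> [] \<Longrightarrow> h (length (slots t)) (fst kv) < length (slots t)"
    using h rep by (auto simp: represents_def)
  moreover have "scan_down (slots t) (free_ptr t) = None"
  proof (cases "scan_down (slots t) (free_ptr t)")
    case (Some q)
    then have "slots t ! q = None" "q < length (slots t)"
      using scan_down_Some[OF Some] rep by (simp_all add: represents_def)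
    then show ?thesis using full' by metis
  qed
  ultimately show ?thesis using full' k by (auto simp: store_def Let_def)
qed

text \<open>Each pair uses up one unit of room, so \<open>the\<close> never meets
  \<open>None\<close> while a rehash reinserts keys.\<close>

lemma fold_store:
  assumes h: "\<And>m k. h (2 ^ m) k < 2 ^ m"
  shows "represents K t \<Longrightarrow> distinct (map fst es) \<Longrightarrow> fst ` set es \<inter> (K \<union> array_range t \<union> {0}) = {} \<Longrightarrow>
    card (K - array_range t) + length es \<le> length (slots t) \<Longrightarrow>
    let t' = fold (\<lambda>e u. the (store h e u)) es t in
      represents (K \<union> fst ` set es) t' \<and> length (array_part t') = length (array_part t) \<and>
      length (slots t') = length (slots t)"
proof (induction es arbitrary: K t)
  case (Cons e es)
  have e: "fst e \<notin> K" "fst e > 0" "fst e \<notin> array_range t" using Cons.prems(3) by auto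
  have "card (K - array_range t) < length (slots t)" using Cons.prems(4) by simp
  then obtain t' where t': "store h e t = Some t'" "represents (insert (fst e) K) t'"
    "length (array_part t') = length (array_part t)" "length (slots t') = length (slots t)"
    by (rule store_Some[OF h Cons.prems(1) e(1,2) disjI2])
  have range: "array_range t' = array_range t" using t'(3) by (simp add: array_range_def)
  have "insert (fst e) K - array_range t = insert (fst e) (K - array_range t)" using e by auto
  then have "card (insert (fst e) K - array_range t') = Suc (card (K - array_range t))"
    using e(1) Cons.prems(1) by (simp add: range represents_def)
  then show ?case
    using Cons.IH[OF t'(2)] Cons.prems(2-4) t' by (auto simp: range Let_def)
qed (simp add: Let_def)

section \<open>Keys before and after a rehash\<close>

lemma map_fst_array_entries:
  "map fst (array_entries t) =
    map Suc (filter (\<lambda>i. array_part t ! i \<noteq> None) [0..<length (array_part t)])"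
proof -
  have "map fst [(Suc i, f i). i \<leftarrow> xs, P i] = map Suc (filter P xs)" for f :: "nat \<Rightarrow> 'v" and xs P
    by (induction xs) auto
  then show ?thesis by (simp add: array_entries_def)
qed

text \<open>No key is listed twice, so the number of reinserted pairs is the cardinality of a key
  set.\<close>

lemma mset_fst_entries:
  assumes rep: "represents K t" and k: "k \<notin> K"
  shows "mset (map fst (array_entries t @ hash_entries t @ [(k, x)])) = mset_set (insert k K)"
proof -
  have fin: "finite K" using rep by (simp add: represents_def)
  have "distinct (map fst (array_entries t))"
    unfolding map_fst_array_entries by (simp add: distinct_map)
  moreover have "set (map fst (array_entries t)) = K \<inter> array_range t"
  proof (intro set_eqI iffI)
    fix y assume "y \<in> K \<inter> array_range t"
    then have "y = Suc (y - 1)" "y - 1 < length (array_part t)" by (auto simp: array_range_def)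
    then show "y \<in> set (map fst (array_entries t))"
      using rep \<open>y \<in> K \<inter> array_range t\<close> unfolding map_fst_array_entries represents_def
      by (auto simp del: One_nat_def intro!: image_eqI[of _ _ "y - 1"])
  qed (use rep in \<open>auto simp: map_fst_array_entries represents_def array_range_def\<close>)
  ultimately have "mset (map fst (array_entries t)) = mset_set (K \<inter> array_range t)"
    by (metis mset_set_set)
  moreover have "mset_set K = mset_set (K \<inter> array_range t) + mset_set (K - array_range t)"
    using fin by (subst mset_set_Union[symmetric]) (auto intro: arg_cong[of _ _ mset_set])
  ultimately show ?thesis using rep k fin by (simp add: represents_def)
qed

text \<open>The new sizes and the cost are functions of the key set \<open>L\<close> alone, whatever
  the previous layout of the table.\<close>

lemma rehash_spec:
  assumes h: "\<And>m k. h (2 ^ m) k < 2 ^ m"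
    and rep: "represents K t" and k: "k \<notin> K" "k > 0"
    and L: "L = insert k K"
  obtains t' where "rehash h (k, x) t = (t', card (L - {1..new_array_size L}))"
    "represents L t'" "length (array_part t') = new_array_size L"
    "length (slots t') = new_hash_size (card (L - {1..new_array_size L}))"
proof -
  define es where "es = array_entries t @ hash_entries t @ [(k, x)]"
  define N where "N = new_array_size L"
  define rest where "rest = filter (\<lambda>e. fst e \<notin> {1..N}) es"
  define M where "M = new_hash_size (length rest)"
  define t0 where "t0 = \<lparr>array_part = map (\<lambda>i. map_of es (Suc i)) [0..<N],
      slots = replicate M None, free_ptr = M\<rparr>"
  define t' where "t' = fold (\<lambda>e u. the (store h e u)) rest t0"
  have fin: "finite L" and L0: "0 \<notin> L" using rep k L by (auto simp: represents_def)
  have mes: "mset (map fst es) = mset_set L"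
    unfolding es_def L using mset_fst_entries[OF rep k(1)] .
  have "set_mset (mset (map fst es)) = L" using fin by (simp only: mes finite_set_mset_mset_set)
  then have keys: "fst ` set es = L" by simp
  have "map fst rest = filter (\<lambda>y. y \<notin> {1..N}) (map fst es)"
    by (simp add: rest_def filter_map o_def)
  then have "mset (map fst rest) = filter_mset (\<lambda>y. y \<notin> {1..N}) (mset_set L)"
    using mes by (simp only: mset_filter)
  also have "\<dots> = mset_set (L - {1..N})"
    using fin by (auto intro!: arg_cong[of _ _ mset_set])
  finally have mrest: "mset (map fst rest) = mset_set (L - {1..N})" .
  then have rest: "fst ` set rest = L - {1..N}"
    by (metis fin finite_Diff finite_set_mset_mset_set list.set_map set_mset_mset)
  have len: "length rest = card (L - {1..N})"
    using arg_cong[OF mrest, of size] by simp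
  then have dist: "distinct (map fst rest)"
    by (metis card_distinct length_map list.set_map rest)
  have range0: "array_range t0 = {1..N}" by (simp add: array_range_def t0_def)
  have pow: "M = 0 \<or> (\<exists>m. M = 2 ^ m)"
    unfolding M_def using new_hash_size_pow2[of "length rest"]
    by (cases "length rest = 0") (auto simp: new_hash_size_def)
  have e: "L \<inter> {1..N} - {1..N} = {}" by auto
  \<comment> \<open>\<open>t0\<close> holds the keys of the new array range and has an empty
    hash-part; \<open>fold_store\<close> then adds the remaining keys.\<close>
  have "represents (L \<inter> {1..N}) t0"
    unfolding represents_def range0 e
  proof (intro conjI allI impI)
    fix i assume "i < length (array_part t0)"
    then show "(array_part t0 ! i \<noteq> None) = (Suc i \<in> L \<inter> {1..N})"
      using keys by (auto simp: t0_def map_of_eq_None_iff)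
  next
    show "image_mset fst (mset (hash_entries t0)) = mset_set {}"
      by (simp add: mset_hash_entries t0_def)
  qed (use fin L0 pow in \<open>auto simp: t0_def\<close>)
  moreover have "fst ` set rest \<inter> (L \<inter> {1..N} \<union> array_range t0 \<union> {0}) = {}"
    using rest L0 by (auto simp: range0)
  moreover have "card (L \<inter> {1..N} - array_range t0) + length rest \<le> length (slots t0)"
    using new_hash_size_ge[of "length rest"] unfolding range0 e by (simp add: t0_def M_def)
  ultimately have "represents (L \<inter> {1..N} \<union> fst ` set rest) t'"
    "length (array_part t') = length (array_part t0)" "length (slots t') = length (slots t0)"
    using fold_store[OF h, of "L \<inter> {1..N}" t0 rest] dist by (auto simp: t'_def Let_def)
  moreover have "L \<inter> {1..N} \<union> fst ` set rest = L" using rest by auto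
  moreover have "rehash h (k, x) t = (t', length rest)"
    unfolding rehash_def Let_def t'_def t0_def M_def rest_def N_def es_def[symmetric] keys ..
  ultimately show ?thesis using that[of t'] by (simp add: len t0_def M_def N_def)
qed

lemma insert_pair_cases:
  assumes h: "\<And>m k. h (2 ^ m) k < 2 ^ m"
    and rep: "represents K t" and k: "k \<notin> K" "k > 0"
    and L: "L = insert k K"
  obtains (stored) t' where "insert_pair h (k, x) (t, c) = (t', c + 1)" "represents L t'"
      "length (array_part t') = length (array_part t)" "length (slots t') = length (slots t)"
  | (rehashed) t' r where "insert_pair h (k, x) (t, c) = (t', c + 1 + r)" "represents L t'"
      "k \<notin> {1..length (array_part t)}" "card (K - {1..length (array_part t)}) = length (slots t)"
      "length (array_part t') = new_array_size L"
      "r = card (L - {1..new_array_size L})" "length (slots t') = new_hash_size r"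
proof (cases "k \<in> array_range t \<or> card (K - array_range t) < length (slots t)")
  case True
  obtain t' where "store h (k, x) t = Some t'" "represents (insert (fst (k, x)) K) t'"
    "length (array_part t') = length (array_part t)" "length (slots t') = length (slots t)"
    by (rule store_Some[OF h rep, where kv = "(k, x)"]) (use k True in simp_all)
  then show ?thesis using stored by (simp add: insert_pair_def L)
next
  case False
  then have full: "card (K - array_range t) = length (slots t)"
    using represents_card_le[OF rep] by simp
  have "store h (k, x) t = None" using store_None[OF h rep _ full] False by simp
  obtain t' where "rehash h (k, x) t = (t', card (L - {1..new_array_size L}))"
    "represents L t'" "length (array_part t') = new_array_size L"
    "length (slots t') = new_hash_size (card (L - {1..new_array_size L}))"
    by (rule rehash_spec[OF h rep k L])
  with \<open>store h (k, x) t = None\<close> show ?thesis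
    using False full by (intro rehashed) (auto simp: insert_pair_def array_range_def)
qed

subsection \<open>Bounding the number of calls\<close>

text \<open>
  Exponents of the array sizes up to \<open>N\<close> that a rehash can produce: the small ones, before time \<open>T\<close>, and
  those within a factor \<open>2 ^ d\<close> of \<open>n\<close>. Each of them pays for one rehash that enlarges the array-part.
\<close>

definition levels :: "nat \<Rightarrow> nat \<Rightarrow> nat \<Rightarrow> nat \<Rightarrow> nat set" where
  "levels A d n N = {a. 2 ^ a \<le> N \<and> (a \<le> A \<or> n \<le> 2 ^ (a + d))}"

lemma finite_levels: "finite (levels A d n N)"
proof (rule finite_subset)
  show "levels A d n N \<subseteq> {..N}"
    by (auto simp: levels_def intro: order_trans[OF less_imp_le[OF less_exp]])
qed simp

lemma card_levels_le:
  assumes "N \<le> 2 * n"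
  shows "card (levels A d n N) \<le> A + d + 3"
proof -
  define B where "B = {a. 2 ^ a \<le> N \<and> n \<le> 2 ^ (a + d)}"
  have "card B \<le> d + 2"
  proof (cases "B = {}")
    case False
    define l where "l = (LEAST a. a \<in> B)"
    have l: "l \<in> B" using False LeastI_ex[of "\<lambda>a. a \<in> B"] by (auto simp: l_def)
    have "B \<subseteq> {l..<l + (d + 2)}"
    proof
      fix a assume a: "a \<in> B"
      \<comment> \<open>\<open>2 ^ a \<le> N \<le> 2 * n \<le> 2 * 2 ^ (l + d)\<close>, so
        \<open>B\<close> lies within \<open>d + 2\<close> consecutive exponents.\<close>
      have "(2::nat) ^ a \<le> 2 ^ (l + d + 1)" using a l assms by (simp add: B_def)
      then have "a \<le> l + d + 1" by (rule power_le_imp_le_exp[rotated]) simp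
      then show "a \<in> {l..<l + (d + 2)}" using a Least_le[of "\<lambda>a. a \<in> B"] by (auto simp: l_def)
    qed
    then show ?thesis using card_mono[of "{l..<l + (d + 2)}" B] by simp
  qed simp
  moreover have "card (levels A d n N) \<le> card ({..A} \<union> B)"
  proof (rule card_mono)
    show "finite ({..A} \<union> B)"
      using finite_levels[of A d n N] by (auto simp: levels_def B_def intro: rev_finite_subset)
  qed (auto simp: levels_def B_def)
  moreover have "card ({..A} \<union> B) \<le> card {..A} + card B" by (rule card_Un_le)
  ultimately show ?thesis by simp
qed

text \<open>Amortised analysis: the calls are bounded by one per insertion plus a potential, namely
  \<open>3 * n\<close> per level reached and twice the hash-part size. Up to the factor
  \<open>2 ^ d\<close>, \<open>late\<close> says
  \<open>2 ^ j + 2 * n / 2 ^ d < 2 * T\<close>.\<close>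

lemma insertion_calls_invariant:
  fixes xs :: "(nat \<times> 'v) list"
  assumes h: "\<And>m k. h (2 ^ m) k < 2 ^ m"
    and n: "n \<le> 2 ^ (j + 1)" and late: "2 ^ j * 2 ^ d + 2 * n < 2 * T * 2 ^ d"
  shows "distinct (map fst xs) \<Longrightarrow> fst ` set xs \<subseteq> {1..n} \<Longrightarrow>
    (\<And>a. majority (fst ` set (take T xs)) a \<Longrightarrow> a \<le> A) \<Longrightarrow>
    fold (insert_pair h) xs (empty_table, 0) = (t, c) \<Longrightarrow>
    represents (fst ` set xs) t \<and>
    (length (array_part t) = 0 \<or>
      (\<exists>a. length (array_part t) = 2 ^ a \<and> majority (fst ` set xs) a)) \<and>
    length (slots t) \<le> 2 * n \<and>
    c \<le> length xs + 3 * n * card (levels A d n (length (array_part t))) + 2 * length (slots t)"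
proof (induction xs arbitrary: t c rule: rev_induct)
  case Nil
  then show ?case
    by (auto simp: represents_def empty_table_def mset_hash_entries array_range_def)
next
  case (snoc e xs)
  obtain k x where e: "e = (k, x)" by fastforce
  obtain t1 c1 where 1: "fold (insert_pair h) xs (empty_table, 0) = (t1, c1)" by fastforce
  define K where "K = fst ` set xs"
  define L where "L = insert k K"
  define N where "N = length (array_part t1)"
  define M where "M = length (slots t1)"
  have L': "fst ` set (xs @ [e]) = L" by (simp add: L_def K_def e)
  have step: "insert_pair h (k, x) (t1, c1) = (t, c)" using snoc.prems(4) 1 e by simp
  have KL: "K \<subseteq> L" and k: "k \<notin> K" "k > 0" and Ln: "L \<subseteq> {1..n}" and fin: "finite L"
    using snoc.prems(1,2) by (auto simp: L_def K_def e)
  have cardK: "card K = length xs"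
    using snoc.prems(1) unfolding K_def by (metis distinct_append distinct_card length_map list.set_map map_append)
  have cardL: "card L = length xs + 1"
    using k(1) fin by (simp add: L_def cardK)
  have Lcard: "card L \<le> n" using card_mono[OF _ Ln] by simp
  have "a \<le> A" if "majority (fst ` set (take T xs)) a" for a
    using that by (intro snoc.prems(3)) (auto elim: majority_mono)
  then have IH: "represents K t1" "N = 0 \<or> (\<exists>a. N = 2 ^ a \<and> majority K a)"
      "M \<le> 2 * n" "c1 \<le> length xs + 3 * n * card (levels A d n N) + 2 * M"
    using snoc.IH[OF _ _ _ 1] snoc.prems(1,2) by (auto simp: K_def N_def M_def)
  show ?case
  proof (cases rule: insert_pair_cases[where h = h, OF h IH(1) k L_def, where x = x and c = c1, case_names stored rehashed])
    case (stored t')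
    then have "t' = t" "c = c1 + 1" using step by auto
    then show ?thesis using stored IH majority_mono[OF _ KL]
      unfolding L' N_def M_def by auto
  next
    case (rehashed t' r)
    define N' where "N' = length (array_part t)"
    define M' where "M' = length (slots t)"
    have eqs: "t' = t" "c = c1 + 1 + r" using rehashed step by auto
    then have N': "N' = new_array_size L" and r: "r = card (L - {1..N'})"
      and M': "M' = new_hash_size r" and full: "card (K - {1..N}) = M" and kN: "k \<notin> {1..N}"
      using rehashed by (auto simp: N'_def M'_def N_def M_def)
    have "r \<le> card L" unfolding r using fin by (intro card_mono) auto
    then have rn: "r \<le> n" using Lcard by simp
    have "M \<le> card K" unfolding full[symmetric] using fin KL by (intro card_mono) (auto intro: finite_subset)
    then have Mt: "M < card L" using cardK cardL by simp
    \<comment> \<open>Keys only accumulate, so the majority behind the old array size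
      survives.\<close>
    have NN: "N \<le> N'"
      using IH(2) new_array_size_ge[OF fin] majority_mono[OF _ KL] unfolding N' by auto
    have maj: "N' = 0 \<or> (\<exists>a. N' = 2 ^ a \<and> majority L a)"
      unfolding N' using new_array_size_cases[OF fin] by metis
    \<comment> \<open>The growth of the potential pays for the \<open>r\<close>
      reinsertions.\<close>
    have "r + 3 * n * card (levels A d n N) + 2 * M \<le> 3 * n * card (levels A d n N') + 2 * M'"
    proof (cases "N' = N")
      case True
      have "L - {1..N} = insert k (K - {1..N})" using kN by (auto simp: L_def)
      then have r': "r = M + 1"
        using k(1) fin full by (simp add: r True L_def)
      obtain m where m: "M' = 2 ^ m" "r \<le> 2 ^ m" using new_hash_size_pow2[of r] r' M' by auto
      \<comment> \<open>With the same array-part, one more key overflows a full hash-part whose size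
        is a power of two, so the next power is at least twice as large. An empty hash-part is no
        power of two and is treated apart.\<close>
      have "M + 1 \<le> M'" "M \<noteq> 0 \<Longrightarrow> 2 * M \<le> M'"
      proof -
        show "M + 1 \<le> M'" using m r' by simp
        assume "M \<noteq> 0"
        then obtain l where l: "M = 2 ^ l" using IH(1) by (auto simp: represents_def M_def)
        then have "(2::nat) ^ l < 2 ^ m" using m r' by linarith
        then have "l < m" by simp
        then have "(2::nat) ^ Suc l \<le> 2 ^ m" by (intro power_increasing) auto
        then show "2 * M \<le> M'" using l m by simp
      qed
      then have "r + 2 * M \<le> 2 * M'" using r' by (cases "M = 0") auto
      then show ?thesis using True by simp
    next
      case False
      then have less: "N < N'" using NN by simp
      then obtain a where a: "N' = 2 ^ a" "majority L a" using maj by auto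
      \<comment> \<open>An enlargement must be paid by a new level. Before time \<open>T\<close> all
        of \<open>L\<close> is among the first \<open>T\<close> keys, and \<open>a \<le> A\<close>
        is the hypothesis on early majorities.\<close>
      have "a \<le> A \<or> n \<le> 2 ^ (a + d)"
      proof (cases "length xs < T")
        case True
        then show ?thesis using snoc.prems(3)[of a] a(2) L' by simp
      next
        case long: False
        show ?thesis
        proof (cases "n \<le> N * 2 ^ d")
          case True
          also have "N * 2 ^ d \<le> N' * 2 ^ d" using less by simp
          finally show ?thesis by (simp add: a(1) power_add)
        next
          case False
          \<comment> \<open>The full hash-part is so large that its size, a power of two, is at least \<open>2 ^ j\<close>, hence
            \<open>L\<close> has more than \<open>2 ^ j\<close> keys and the new array-part covers all of \<open>{1..n}\<close>.\<close>
          have "card K \<le> card (K - {1..N}) + card {1..N}"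
            using diff_card_le_card_Diff[of "{1..N}" K] by simp
          then have "T \<le> M + N" using long full cardK by simp
          then have "T * 2 ^ d \<le> M * 2 ^ d + N * 2 ^ d"
            by (metis add_mult_distrib mult_le_mono1)
          then have "2 ^ j * 2 ^ d < (2 * M) * 2 ^ d" using late False by linarith
          then have jM: "2 ^ j < 2 * M" by simp
          then obtain l where l: "M = 2 ^ l"
            using IH(1) by (auto simp: represents_def M_def)
          then have "(2::nat) ^ j < 2 ^ Suc l" using jM by simp
          then have "j \<le> l" using power_less_imp_less_exp[of "2::nat" j "Suc l"] by simp
          then have "(2::nat) ^ j \<le> M" by (simp add: l)
          then have "2 ^ j + 1 \<le> card L" using Mt by simp
          moreover have "L \<inter> {1..2 ^ (j + 1)} = L" using Ln n by auto
          ultimately have "majority L (j + 1)" by (simp add: majority_def)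
          then have "n \<le> N'" using new_array_size_ge[OF fin] n unfolding N' by fastforce
          also have "N' \<le> 2 ^ (a + d)" by (simp add: a(1))
          finally show ?thesis ..
        qed
      qed
      then have "a \<in> levels A d n N' - levels A d n N" using a less by (auto simp: levels_def)
      moreover have "levels A d n N \<subseteq> levels A d n N'" using less by (auto simp: levels_def)
      ultimately have "card (levels A d n N) < card (levels A d n N')"
        by (intro psubset_card_mono finite_levels) auto
      then have "card (levels A d n N) + 1 \<le> card (levels A d n N')" by simp
      then have "3 * n * (card (levels A d n N) + 1) \<le> 3 * n * card (levels A d n N')"
        by (rule mult_le_mono2)
      \<comment> \<open>The \<open>3 * n\<close> of a new level splits into \<open>n\<close> for the
        reinsertions and \<open>2 * n\<close> for the lost potential of the old hash-part.\<close>
      moreover have "r + 2 * M \<le> 3 * n" using rn Mt Lcard by simp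
      ultimately show ?thesis by (simp add: algebra_simps)
    qed
    moreover have "M' \<le> 2 * n" using new_hash_size_le[of r] rn M' by simp
    ultimately show ?thesis
      using IH(4) rehashed(2) maj unfolding L' eqs N'_def[symmetric] M'_def[symmetric] by auto
  qed
qed

lemma insertion_calls_le:
  fixes xs :: "(nat \<times> 'v) list"
  assumes h: "\<And>m k. h (2 ^ m) k < 2 ^ m"
    and n: "n \<le> 2 ^ (j + 1)" and late: "2 ^ j * 2 ^ d + 2 * n < 2 * T * 2 ^ d"
    and xs: "distinct (map fst xs)" "fst ` set xs \<subseteq> {1..n}"
    and early: "\<And>a. majority (fst ` set (take T xs)) a \<Longrightarrow> a \<le> A"
  shows "insertion_calls h xs \<le> n * (3 * A + 3 * d + 14)"
proof -
  obtain t c where fold: "fold (insert_pair h) xs (empty_table, 0) = (t, c)" by fastforce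
  note inv = insertion_calls_invariant[OF h n late xs early fold]
  have lenxs: "card (fst ` set xs) = length xs"
    using xs(1) by (metis distinct_card length_map list.set_map)
  have len: "length xs \<le> n"
    using card_mono[OF _ xs(2)] lenxs by simp
  \<comment> \<open>More than half of the array range consists of inserted keys, of which there are
    at most \<open>n\<close>.\<close>
  have "length (array_part t) \<le> 2 * n"
    using inv len lenxs majority_imp_less[of "fst ` set xs"] by fastforce
  then have "3 * n * card (levels A d n (length (array_part t))) \<le> 3 * n * (A + d + 3)"
    by (intro mult_le_mono2 card_levels_le)
  then have "c \<le> n + 3 * n * (A + d + 3) + 4 * n" using inv len by linarith
  then show ?thesis by (simp add: insertion_calls_def fold algebra_simps)
qed

subsection \<open>Hypergeometric concentration\<close>

text \<open>One transposition sends \<open>j\<close> to \<open>i\<close>; a second sends the image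
  of \<open>j'\<close> to \<open>i'\<close> without touching \<open>i\<close>. Hence all ordered
  pairs of distinct positions are equivalent.\<close>

lemma permutes_moving_pair:
  assumes "i \<in> U" "i' \<in> U" "j \<in> U" "j' \<in> U" "i \<noteq> i'" "j \<noteq> j'"
  obtains \<sigma> where "\<sigma> permutes U" "\<sigma> j = i" "\<sigma> j' = i'"
proof -
  define \<sigma>1 where "\<sigma>1 = Transposition.transpose i j"
  define z where "z = \<sigma>1 j'"
  define \<sigma>2 where "\<sigma>2 = Transposition.transpose z i'"
  have 1: "\<sigma>1 permutes U" unfolding \<sigma>1_def using assms by (intro permutes_swap_id)
  then have z: "z \<in> U" using assms by (simp add: z_def permutes_in_image)
  have "z \<noteq> i" using assms by (auto simp: z_def \<sigma>1_def Transposition.transpose_def)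
  then have "(\<sigma>2 \<circ> \<sigma>1) j = i" "(\<sigma>2 \<circ> \<sigma>1) j' = i'"
    using assms z_def by (auto simp: \<sigma>1_def \<sigma>2_def Transposition.transpose_def)
  moreover have "\<sigma>2 \<circ> \<sigma>1 permutes U"
    using 1 z assms by (intro permutes_compose) (auto simp: \<sigma>2_def intro: permutes_swap_id)
  ultimately show ?thesis using that by blast
qed

text \<open>Composing with \<open>\<sigma>\<close> on the right is a bijection of the permutations
  of \<open>U\<close>, so relabelling positions does not change frequencies.\<close>

lemma card_permutations_reindex:
  assumes "\<sigma> permutes U"
  shows "card {\<pi>. \<pi> permutes U \<and> Q (\<pi> \<circ> \<sigma>)} = card {\<pi>. \<pi> permutes U \<and> Q \<pi>}"
proof (rule bij_betw_same_card)
  show "bij_betw (\<lambda>\<pi>. \<pi> \<circ> \<sigma>) {\<pi>. \<pi> permutes U \<and> Q (\<pi> \<circ> \<sigma>)} {\<pi>. \<pi> permutes U \<and> Q \<pi>}"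
    by (rule bij_betwI[where g = "\<lambda>\<pi>. \<pi> \<circ> inv \<sigma>"])
      (use assms in \<open>auto simp: permutes_compose permutes_inv o_assoc[symmetric] permutes_inv_o\<close>)
qed

lemma permutes_preimage_sum:
  assumes "\<pi> permutes U" "finite U" "S \<subseteq> U"
  shows "(\<Sum>i\<in>U. of_bool (\<pi> i \<in> S)) = (of_nat (card S) :: 'a :: semiring_1)"
proof -
  have "(\<Sum>i\<in>U. of_bool (\<pi> i \<in> S)) = (\<Sum>i\<in>U. of_bool (i \<in> S) :: 'a)"
    using sum.permute[OF assms(1), of "\<lambda>i. of_bool (i \<in> S) :: 'a"] unfolding comp_def by (rule sym)
  also have "\<dots> = of_nat (card (U \<inter> S))" using assms(2) by simp
  also have "U \<inter> S = S" using assms(3) by auto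
  finally show ?thesis .
qed

text \<open>
  The frequencies do not depend on the chosen positions, so they are determined by their sum over
  all positions, which is the same for every permutation.
\<close>

lemma card_permutations_hit:
  assumes U: "finite U" "S \<subseteq> U" and i: "i \<in> U"
  shows "card U * card {\<pi>. \<pi> permutes U \<and> \<pi> i \<in> S} = card S * card {\<pi>. \<pi> permutes U}"
proof -
  let ?P = "{\<pi>. \<pi> permutes U}"
  have fin: "finite ?P" using U(1) by (rule finite_permutations)
  have same: "card {\<pi>. \<pi> permutes U \<and> \<pi> j \<in> S} = card {\<pi>. \<pi> permutes U \<and> \<pi> i \<in> S}" if "j \<in> U" for j
    using card_permutations_reindex[OF permutes_swap_id[OF that i], of "\<lambda>\<pi>. \<pi> i \<in> S"] by simp
  have "card U * card {\<pi>. \<pi> permutes U \<and> \<pi> i \<in> S} = (\<Sum>j\<in>U. card {\<pi>. \<pi> permutes U \<and> \<pi> j \<in> S})"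
    by (simp add: same)
  also have "\<dots> = (\<Sum>j\<in>U. \<Sum>\<pi>\<in>?P. of_bool (\<pi> j \<in> S))"
    using fin by (simp add: Collect_conj_eq)
  also have "\<dots> = (\<Sum>\<pi>\<in>?P. \<Sum>j\<in>U. of_bool (\<pi> j \<in> S))" by (rule sum.swap)
  also have "\<dots> = (\<Sum>\<pi>\<in>?P. card S)"
    using permutes_preimage_sum[OF _ U, where 'a = nat] by (intro sum.cong) auto
  finally show ?thesis by (simp add: mult.commute)
qed

text \<open>The same double counting over ordered pairs of distinct positions: every permutation
  sends exactly \<open>card S * (card S - 1)\<close> of them into \<open>S\<close>.\<close>

lemma card_permutations_hit_pair:
  assumes U: "finite U" "S \<subseteq> U" and i: "i \<in> U" "i' \<in> U" "i \<noteq> i'"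
  shows "card U * (card U - 1) * card {\<pi>. \<pi> permutes U \<and> \<pi> i \<in> S \<and> \<pi> i' \<in> S} =
    card S * (card S - 1) * card {\<pi>. \<pi> permutes U}"
proof -
  let ?P = "{\<pi>. \<pi> permutes U}" and ?D = "SIGMA j:U. U - {j}"
  have fin: "finite ?P" using U(1) by (rule finite_permutations)
  have same: "card {\<pi>. \<pi> permutes U \<and> \<pi> j \<in> S \<and> \<pi> j' \<in> S} =
      card {\<pi>. \<pi> permutes U \<and> \<pi> i \<in> S \<and> \<pi> i' \<in> S}" if "j \<in> U" "j' \<in> U - {j}" for j j'
  proof -
    have "j \<in> U" "j' \<in> U" "j \<noteq> j'" using that by auto
    then obtain \<sigma> where "\<sigma> permutes U" "\<sigma> j = i" "\<sigma> j' = i'"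
      using permutes_moving_pair[OF i(1,2) _ _ i(3)] by blast
    then show ?thesis
      using card_permutations_reindex[of \<sigma> U "\<lambda>\<pi>. \<pi> j \<in> S \<and> \<pi> j' \<in> S"] by simp
  qed
  have "card U * (card U - 1) * card {\<pi>. \<pi> permutes U \<and> \<pi> i \<in> S \<and> \<pi> i' \<in> S} =
      (\<Sum>j\<in>U. \<Sum>j'\<in>U - {j}. card {\<pi>. \<pi> permutes U \<and> \<pi> j \<in> S \<and> \<pi> j' \<in> S})"
    using U(1) by (simp add: same)
  also have "\<dots> = (\<Sum>(j, j')\<in>?D. card {\<pi>. \<pi> permutes U \<and> \<pi> j \<in> S \<and> \<pi> j' \<in> S})"
    using U(1) by (subst sum.Sigma) auto
  also have "\<dots> = (\<Sum>p\<in>?D. \<Sum>\<pi>\<in>?P. of_bool (\<pi> (fst p) \<in> S \<and> \<pi> (snd p) \<in> S))"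
    using fin by (simp add: Collect_conj_eq case_prod_beta)
  also have "\<dots> = (\<Sum>\<pi>\<in>?P. \<Sum>p\<in>?D. of_bool (\<pi> (fst p) \<in> S \<and> \<pi> (snd p) \<in> S))" by (rule sum.swap)
  also have "\<dots> = (\<Sum>\<pi>\<in>?P. card S * (card S - 1))"
  proof (intro sum.cong refl)
    fix \<pi> assume "\<pi> \<in> ?P"
    then have \<pi>: "\<pi> permutes U" by simp
    define V where "V = {j \<in> U. \<pi> j \<in> S}"
    have "finite V" using U by (simp add: V_def)
    have V: "card V = card S"
      using permutes_preimage_sum[OF \<pi> U, where 'a = nat] U(1)
      by (simp add: V_def Collect_conj_eq)
    have "(\<Sum>p\<in>?D. of_bool (\<pi> (fst p) \<in> S \<and> \<pi> (snd p) \<in> S)) =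
        card (?D \<inter> {p. \<pi> (fst p) \<in> S \<and> \<pi> (snd p) \<in> S})"
      using U(1) by simp
    also have "?D \<inter> {p. \<pi> (fst p) \<in> S \<and> \<pi> (snd p) \<in> S} = (SIGMA j:V. V - {j})"
      by (auto simp: V_def)
    also have "card \<dots> = card V * (card V - 1)" using \<open>finite V\<close> by simp
    finally show "(\<Sum>p\<in>?D. of_bool (\<pi> (fst p) \<in> S \<and> \<pi> (snd p) \<in> S)) = card S * (card S - 1)"
      by (simp add: V)
  qed
  finally show ?thesis by (simp add: mult.commute)
qed

text \<open>Hits at distinct positions are negatively correlated, so the variance is at most the
  mean \<open>\<mu>\<close>. Sums over permutations stay unnormalised, hence the factor on the
  right.\<close>

lemma permutation_hits_variance:
  fixes U :: "'a set"
  assumes U: "finite U" "U \<noteq> {}" "S \<subseteq> U" "I \<subseteq> U"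
  defines "X \<equiv> \<lambda>\<pi>. real (card {i \<in> I. \<pi> i \<in> S})"
    and "\<mu> \<equiv> real (card I) * real (card S) / real (card U)"
  shows "(\<Sum>\<pi> | \<pi> permutes U. (X \<pi> - \<mu>)\<^sup>2) \<le> \<mu> * real (card {\<pi>. \<pi> permutes U})"
proof -
  let ?P = "{\<pi>. \<pi> permutes U}"
  define u s l p where "u = real (card U)" and "s = real (card S)" and "l = real (card I)"
    and "p = real (card ?P)"
  have finP: "finite ?P" using U(1) by (rule finite_permutations)
  have finI: "finite I" using U finite_subset by blast
  have u: "u \<ge> 1" unfolding u_def using U(1,2) by (simp add: card_gt_0_iff Suc_le_eq)
  have su: "s \<le> u" "l \<le> u" unfolding s_def l_def u_def using U by (auto intro: card_mono)
  have X: "X \<pi> = (\<Sum>i\<in>I. of_bool (\<pi> i \<in> S))" for \<pi>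
    unfolding X_def using finI by (simp add: Collect_conj_eq)
  have hit: "(\<Sum>\<pi>\<in>?P. of_bool (\<pi> i \<in> S)) = s / u * p" if "i \<in> I" for i
  proof -
    have "i \<in> U" using that U(4) by auto
    then have "u * real (card {\<pi>. \<pi> permutes U \<and> \<pi> i \<in> S}) = s * p"
      using arg_cong[OF card_permutations_hit[OF U(1,3), of i], of real]
      by (simp add: u_def s_def p_def)
    moreover have "(\<Sum>\<pi>\<in>?P. of_bool (\<pi> i \<in> S)) = real (card {\<pi>. \<pi> permutes U \<and> \<pi> i \<in> S})"
      using finP by (simp add: Collect_conj_eq)
    ultimately show ?thesis using u by (simp add: field_simps)
  qed
  have pair: "(\<Sum>\<pi>\<in>?P. of_bool (\<pi> i \<in> S) * of_bool (\<pi> i' \<in> S)) \<le> (s / u)\<^sup>2 * p"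
    if "i \<in> I" "i' \<in> I - {i}" for i i'
  proof -
    define q where "q = real (card {\<pi>. \<pi> permutes U \<and> \<pi> i \<in> S \<and> \<pi> i' \<in> S})"
    have "card {i, i'} \<le> card U" using that U by (intro card_mono) auto
    moreover have "card {i, i'} = 2" using that by (subst card_insert_disjoint) auto
    ultimately have u2: "u \<ge> 2" by (simp add: u_def)
    have "i \<in> U" "i' \<in> U" "i \<noteq> i'" using that U(4) by auto
    then have "real (card U * (card U - 1) * card {\<pi>. \<pi> permutes U \<and> \<pi> i \<in> S \<and> \<pi> i' \<in> S}) =
        real (card S * (card S - 1) * card ?P)"
      using card_permutations_hit_pair[OF U(1,3), of i i'] by simp
    moreover have "real (card U - 1) = u - 1" using u by (simp add: u_def of_nat_diff)
    \<comment> \<open>Truncated subtraction is harmless for empty \<open>S\<close> thanks to the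
      factor \<open>s\<close>.\<close>
    moreover have "s * real (card S - 1) = s * (s - 1)"
      by (cases "card S") (auto simp: s_def)
    ultimately have "u * (u - 1) * q = s * (s - 1) * p"
      by (simp add: u_def q_def p_def s_def)
    then have "u * (u * (u - 1) * q) = u * (s * (s - 1) * p)" by simp
    then have "u\<^sup>2 * (u - 1) * q = (u * (s - 1)) * (s * p)" by (simp add: power2_eq_square mult_ac)
    \<comment> \<open>Negative correlation: \<open>u * (s - 1) \<le> s * (u - 1)\<close> amounts to
      \<open>s \<le> u\<close>.\<close>
    also have "\<dots> \<le> (s * (u - 1)) * (s * p)"
      using su by (intro mult_right_mono) (auto simp: algebra_simps s_def p_def)
    finally have "(u - 1) * (u\<^sup>2 * q) \<le> (u - 1) * (s\<^sup>2 * p)" by (simp add: power2_eq_square algebra_simps)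
    then have "u\<^sup>2 * q \<le> s\<^sup>2 * p" using u2 by (simp add: mult_le_cancel_left)
    moreover have "(\<Sum>\<pi>\<in>?P. of_bool (\<pi> i \<in> S) * of_bool (\<pi> i' \<in> S)) = q"
      unfolding q_def of_bool_conj[symmetric] using finP by (simp add: Collect_conj_eq)
    ultimately show ?thesis using u by (simp add: field_simps power2_eq_square)
  qed
  have \<mu>: "\<mu> = l * (s / u)" by (simp add: \<mu>_def l_def s_def u_def)
  have first: "(\<Sum>\<pi>\<in>?P. X \<pi>) = \<mu> * p"
    unfolding X by (subst sum.swap) (simp add: hit \<mu> l_def)
  have "(\<Sum>\<pi>\<in>?P. (X \<pi>)\<^sup>2) = (\<Sum>\<pi>\<in>?P. \<Sum>i\<in>I. \<Sum>i'\<in>I. of_bool (\<pi> i \<in> S) * of_bool (\<pi> i' \<in> S))"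
    unfolding X by (simp add: power2_eq_square sum_product)
  also have "\<dots> = (\<Sum>i\<in>I. \<Sum>i'\<in>I. \<Sum>\<pi>\<in>?P. of_bool (\<pi> i \<in> S) * of_bool (\<pi> i' \<in> S))"
    by (subst sum.swap, intro sum.cong refl, rule sum.swap)
  \<comment> \<open>On the diagonal the square of an indicator is the indicator itself.\<close>
  also have "\<dots> = (\<Sum>i\<in>I. (\<Sum>\<pi>\<in>?P. of_bool (\<pi> i \<in> S)) +
      (\<Sum>i'\<in>I - {i}. \<Sum>\<pi>\<in>?P. of_bool (\<pi> i \<in> S) * of_bool (\<pi> i' \<in> S)))"
    using finI by (intro sum.cong refl) (simp add: sum.remove flip: of_bool_conj)
  also have "\<dots> \<le> (\<Sum>i\<in>I. s / u * p + (\<Sum>i'\<in>I - {i}. (s / u)\<^sup>2 * p))"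
    by (intro sum_mono add_mono) (use hit pair in auto)
  also have "\<dots> \<le> (\<Sum>i\<in>I. s / u * p + l * ((s / u)\<^sup>2 * p))"
  proof (intro sum_mono add_left_mono)
    fix i
    have "real (card (I - {i})) \<le> l" unfolding l_def using finI by (simp add: card_Diff1_le)
    then show "(\<Sum>i'\<in>I - {i}. (s / u)\<^sup>2 * p) \<le> l * ((s / u)\<^sup>2 * p)"
      by (simp add: mult_right_mono p_def)
  qed
  also have "\<dots> = \<mu> * p + \<mu>\<^sup>2 * p"
    by (simp add: \<mu> l_def[symmetric] power2_eq_square algebra_simps)
  finally have second: "(\<Sum>\<pi>\<in>?P. (X \<pi>)\<^sup>2) \<le> \<mu> * p + \<mu>\<^sup>2 * p" .
  have "(\<Sum>\<pi>\<in>?P. (X \<pi> - \<mu>)\<^sup>2) = (\<Sum>\<pi>\<in>?P. (X \<pi>)\<^sup>2) - 2 * \<mu> * (\<Sum>\<pi>\<in>?P. X \<pi>) + \<mu>\<^sup>2 * p"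
    by (simp add: power2_diff sum.distrib sum_subtractf sum_distrib_left p_def algebra_simps)
  also have "\<dots> \<le> \<mu> * p" using second unfolding first by (simp add: power2_eq_square algebra_simps)
  finally show ?thesis by (simp add: p_def)
qed

text \<open>Markov's inequality for the squared deviation, restricted to the upper tail.\<close>

lemma permutation_hits_Chebyshev:
  fixes U :: "'a set"
  assumes U: "finite U" "U \<noteq> {}" "S \<subseteq> U" "I \<subseteq> U" and c: "c > 0"
  defines "\<mu> \<equiv> real (card I) * real (card S) / real (card U)"
  shows "measure_pmf.prob (pmf_of_set {\<pi>. \<pi> permutes U}) {\<pi>. real (card {i \<in> I. \<pi> i \<in> S}) \<ge> \<mu> + c}
    \<le> \<mu> / c\<^sup>2"
proof -
  let ?P = "{\<pi>. \<pi> permutes U}" and ?X = "\<lambda>\<pi>. real (card {i \<in> I. \<pi> i \<in> S})"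
  let ?B = "{\<pi>. ?X \<pi> \<ge> \<mu> + c}"
  have fin: "finite ?P" using U(1) by (rule finite_permutations)
  have ne: "?P \<noteq> {}" using permutes_id by blast
  have "real (card (?P \<inter> ?B)) * c\<^sup>2 = (\<Sum>\<pi>\<in>?P \<inter> ?B. c\<^sup>2)" by simp
  also have "\<dots> \<le> (\<Sum>\<pi>\<in>?P \<inter> ?B. (?X \<pi> - \<mu>)\<^sup>2)"
    using c by (intro sum_mono power_mono) auto
  also have "\<dots> \<le> (\<Sum>\<pi>\<in>?P. (?X \<pi> - \<mu>)\<^sup>2)" using fin by (intro sum_mono2) auto
  also have "\<dots> \<le> \<mu> * real (card ?P)"
    unfolding \<mu>_def by (rule permutation_hits_variance[OF U])
  finally have "real (card (?P \<inter> ?B)) * c\<^sup>2 \<le> \<mu> * real (card ?P)" .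
  then show ?thesis
    using c fin ne unfolding measure_pmf_of_set[OF ne fin] by (simp add: divide_simps card_gt_0_iff)
qed

subsection \<open>Majorities in random prefixes\<close>

text \<open>The mean number of hits is at most \<open>(1 / 2 - \<epsilon>) * 2 ^ a\<close>, so a
  majority exceeds it by at least \<open>\<epsilon> * 2 ^ a\<close>, and Chebyshev applies with
  variance at most \<open>2 ^ a\<close>. If \<open>2 ^ a > n\<close>, then
  \<open>T \<le> n / 2\<close> keys are too few for a majority.\<close>

lemma prob_majority_le:
  assumes n: "n > 0" and \<epsilon>: "\<epsilon> > 0" and T: "real T \<le> (1 / 2 - \<epsilon>) * real n"
  shows "measure_pmf.prob (pmf_of_set {\<pi>. \<pi> permutes {1..n}}) {\<pi>. majority (\<pi> ` {1..T}) a}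
    \<le> 1 / \<epsilon>\<^sup>2 * (1 / 2) ^ a"
proof (cases "2 ^ a \<le> n")
  case True
  define s :: real where "s = 2 ^ a"
  define \<mu> where "\<mu> = real (card {1..T}) * real (card {1..(2::nat) ^ a}) / real (card {1..n})"
  have s: "s > 0" by (simp add: s_def)
  have "0 < \<epsilon> * s" using s \<epsilon> by simp
  have "real T / real n \<le> 1 / 2 - \<epsilon>" using T n by (simp add: pos_divide_le_eq)
  then have "real T / real n * s \<le> (1 / 2 - \<epsilon>) * s" using s by (intro mult_right_mono) auto
  then have \<mu>: "\<mu> \<le> s / 2 - \<epsilon> * s" by (simp add: \<mu>_def s_def left_diff_distrib)
  have "0 \<le> \<epsilon> * real n" using \<epsilon> by simp
  then have "real T \<le> real n" using T unfolding left_diff_distrib by linarith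
  then have sub: "{1..T} \<subseteq> {1..n}" by auto
  have "{\<pi>. majority (\<pi> ` {1..T}) a} \<subseteq>
      {\<pi>. real (card {i \<in> {1..T}. \<pi> i \<in> {1..2 ^ a}}) \<ge> \<mu> + \<epsilon> * s}"
  proof (intro subsetI CollectI)
    fix \<pi> :: "nat \<Rightarrow> nat" assume "\<pi> \<in> {\<pi>. majority (\<pi> ` {1..T}) a}"
    then have "2 ^ a div 2 + 1 \<le> card (\<pi> ` {1..T} \<inter> {1..2 ^ a})" by (simp add: majority_def)
    also have "\<pi> ` {1..T} \<inter> {1..2 ^ a} = \<pi> ` {i \<in> {1..T}. \<pi> i \<in> {1..2 ^ a}}" by auto
    also have "card \<dots> \<le> card {i \<in> {1..T}. \<pi> i \<in> {1..2 ^ a}}" by (intro card_image_le) auto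
    finally have "2 ^ a \<le> 2 * card {i \<in> {1..T}. \<pi> i \<in> {1..2 ^ a}}" by linarith
    then have "real (2 ^ a) \<le> real (2 * card {i \<in> {1..T}. \<pi> i \<in> {1..2 ^ a}})"
      by (rule of_nat_mono)
    then have "s \<le> 2 * real (card {i \<in> {1..T}. \<pi> i \<in> {1..2 ^ a}})" unfolding s_def by simp
    then show "\<mu> + \<epsilon> * s \<le> real (card {i \<in> {1..T}. \<pi> i \<in> {1..2 ^ a}})" using \<mu> by linarith
  qed
  then have "measure_pmf.prob (pmf_of_set {\<pi>. \<pi> permutes {1..n}}) {\<pi>. majority (\<pi> ` {1..T}) a} \<le>
      measure_pmf.prob (pmf_of_set {\<pi>. \<pi> permutes {1..n}})
        {\<pi>. real (card {i \<in> {1..T}. \<pi> i \<in> {1..2 ^ a}}) \<ge> \<mu> + \<epsilon> * s}"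
    by (intro measure_pmf.finite_measure_mono) auto
  also have "\<dots> \<le> \<mu> / (\<epsilon> * s)\<^sup>2"
    unfolding \<mu>_def using True n sub \<epsilon> s by (intro permutation_hits_Chebyshev) auto
  also have "\<dots> \<le> s / (\<epsilon> * s)\<^sup>2"
    using \<mu> \<open>0 < \<epsilon> * s\<close> s by (intro divide_right_mono) simp_all
  also have "\<dots> = 1 / \<epsilon>\<^sup>2 * (1 / 2) ^ a"
    using s by (simp add: power_one_over s_def[symmetric] power2_eq_square)
  finally show ?thesis .
next
  case False
  have "\<not> majority (\<pi> ` {1..T}) a" for \<pi> :: "nat \<Rightarrow> nat"
  proof
    assume "majority (\<pi> ` {1..T}) a"
    then have "2 ^ a < 2 * card (\<pi> ` {1..T})" by (intro majority_imp_less) auto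
    also have "\<dots> \<le> 2 * T" using card_image_le[of "{1..T}" \<pi>] by simp
    finally have "n < 2 * T" using False by simp
    moreover have "0 \<le> \<epsilon> * real n" using \<epsilon> by simp
    then have "2 * real T \<le> real n" using T unfolding left_diff_distrib by linarith
    ultimately show False by linarith
  qed
  then show ?thesis using \<epsilon> by simp
qed

lemma sum_half_powers_le: "(\<Sum>a\<in>{A<..B}. (1 / 2) ^ a) \<le> ((1 / 2) ^ A :: real)"
proof -
  have "(\<Sum>a\<in>{A<..B}. (1 / 2) ^ a) = ((1 / 2) ^ A - (1 / 2) ^ B :: real)" if "A \<le> B" for B
    using that
  proof (induction B rule: dec_induct)
    case (step B)
    have "{A<..Suc B} = insert (Suc B) {A<..B}" using step.hyps by auto
    then show ?case using step.IH by simp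
  qed simp
  then show ?thesis by (cases "A \<le> B") simp_all
qed

text \<open>Union bound with a geometric tail; exponents beyond \<open>2 * T\<close> cannot have a
  majority among \<open>T\<close> keys.\<close>

lemma prob_large_majority_le:
  assumes n: "n > 0" and \<epsilon>: "\<epsilon> > 0" and T: "real T \<le> (1 / 2 - \<epsilon>) * real n"
  shows "measure_pmf.prob (pmf_of_set {\<pi>. \<pi> permutes {1..n}}) {\<pi>. \<exists>a>A. majority (\<pi> ` {1..T}) a}
    \<le> 1 / \<epsilon>\<^sup>2 * (1 / 2) ^ A"
proof -
  let ?p = "measure_pmf.prob (pmf_of_set {\<pi>. \<pi> permutes {1..n}})"
  have "{\<pi>. \<exists>a>A. majority (\<pi> ` {1..T}) a} \<subseteq> (\<Union>a\<in>{A<..2 * T}. {\<pi>. majority (\<pi> ` {1..T}) a})"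
  proof
    fix \<pi> :: "nat \<Rightarrow> nat" assume "\<pi> \<in> {\<pi>. \<exists>a>A. majority (\<pi> ` {1..T}) a}"
    then obtain a where a: "a > A" "majority (\<pi> ` {1..T}) a" by auto
    then have "a \<le> 2 * card (\<pi> ` {1..T})" by (intro majority_le_card) auto
    also have "\<dots> \<le> 2 * T" using card_image_le[of "{1..T}" \<pi>] by simp
    finally show "\<pi> \<in> (\<Union>a\<in>{A<..2 * T}. {\<pi>. majority (\<pi> ` {1..T}) a})" using a by auto
  qed
  then have "?p {\<pi>. \<exists>a>A. majority (\<pi> ` {1..T}) a} \<le>
      ?p (\<Union>a\<in>{A<..2 * T}. {\<pi>. majority (\<pi> ` {1..T}) a})"
    by (intro measure_pmf.finite_measure_mono) auto
  also have "\<dots> \<le> (\<Sum>a\<in>{A<..2 * T}. ?p {\<pi>. majority (\<pi> ` {1..T}) a})"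
    by (intro measure_pmf.finite_measure_subadditive_finite) auto
  also have "\<dots> \<le> (\<Sum>a\<in>{A<..2 * T}. 1 / \<epsilon>\<^sup>2 * (1 / 2) ^ a)"
    by (intro sum_mono prob_majority_le assms)
  also have "\<dots> \<le> 1 / \<epsilon>\<^sup>2 * (1 / 2) ^ A"
    unfolding sum_distrib_left[symmetric] by (intro mult_left_mono sum_half_powers_le) simp
  finally show ?thesis .
qed

section \<open>Choice of the constants and passage to the limit\<close>

theorem theorem2:
  fixes g :: "nat \<Rightarrow> real" and b :: real
    and h :: "nat \<Rightarrow> nat \<Rightarrow> nat" and v :: "nat \<Rightarrow> 'v"
  assumes "\<And>n. g n > 0"
    and "filterlim g at_top sequentially"
    and "g \<in> o(\<lambda>n. real n)"
    and "1 < b" and "b < 2"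
    and "\<And>m k. h (2 ^ m) k < 2 ^ m"
  shows "\<exists>C>0.
    ((\<lambda>n. measure_pmf.prob (pmf_of_set {\<pi>. \<pi> permutes {1..n}})
         {\<pi>. real (insertion_calls h (map (\<lambda>i. (\<pi> i, v i)) [1..<Suc n])) \<le> C * (real n * g n)})
      \<longlongrightarrow> 1) (inf sequentially (principal (N_set b)))"
proof -
  \<comment> \<open>Then \<open>2 ^ j < n / b = n - 2 * \<eta> * n\<close>. This gap of
    \<open>2 * \<eta> * n\<close> is spent as follows:
    \<open>2 * \<epsilon> * n = \<eta> * n\<close> on \<open>T\<close>, less than
    \<open>\<eta> * n / 2\<close> on \<open>2 * n / 2 ^ d\<close>, and
    \<open>\<eta> * n / 2 \<ge> 2\<close> on rounding \<open>T\<close>, which needs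
    \<open>n \<ge> 4 / \<eta>\<close>.\<close>
  define \<eta> where "\<eta> = (1 - 1 / b) / 2"
  have \<eta>: "0 < \<eta>" "\<eta> < 1" using assms(4) by (auto simp: \<eta>_def field_simps)
  obtain d where d: "(1 / 2) ^ d < \<eta> / 4"
    using real_arch_pow_inv[of "\<eta> / 4" "1 / 2"] \<eta> by auto
  define \<epsilon> where "\<epsilon> = \<eta> / 2"
  define A where "A n = nat \<lfloor>g n\<rfloor>" for n
  define T where "T n = nat \<lfloor>(1 / 2 - \<epsilon>) * real n\<rfloor>" for n :: nat
  \<comment> \<open>For \<open>g n \<ge> 1\<close> and \<open>A n \<le> g n\<close> this turns
    \<open>3 * A n + 3 * d + 14\<close> into at most \<open>C * g n\<close>; it depends only on
    \<open>b\<close>.\<close>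
  define C where "C = 3 * real d + 17"
  let ?p = "\<lambda>n. measure_pmf.prob (pmf_of_set {\<pi>. \<pi> permutes {1..n::nat}})"
  let ?xs = "\<lambda>n \<pi>. map (\<lambda>i. (\<pi> i, v i)) [1..<Suc n]"
  let ?good = "\<lambda>n. {\<pi>. real (insertion_calls h (?xs n \<pi>)) \<le> C * (real n * g n)}"
  have lower: "1 - 1 / \<epsilon>\<^sup>2 * (1 / 2) ^ A n \<le> ?p n (?good n)"
    if g1: "g n \<ge> 1" and large: "real n \<ge> 4 / \<eta>" and nb: "n \<in> N_set b" for n
  proof -
    obtain j where j: "2 ^ j * b < real n" "n \<le> 2 ^ (j + 1)" using nb by (auto simp: N_set_def)
    have n4: "4 \<le> \<eta> * real n" using large \<eta> by (simp add: field_simps)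
    then have n0: "n > 0" by (cases n) auto
    have "0 \<le> (1 / 2 - \<epsilon>) * real n" using \<eta> by (intro mult_nonneg_nonneg) (auto simp: \<epsilon>_def)
    then have T: "real (T n) \<le> (1 / 2 - \<epsilon>) * real n" "(1 / 2 - \<epsilon>) * real n < real (T n) + 1"
      unfolding T_def by (simp_all only: of_nat_floor of_nat_nat zero_le_floor of_int_floor_le
          real_of_int_floor_add_one_gt)
    have "0 \<le> \<epsilon> * real n" using \<eta> by (simp add: \<epsilon>_def)
    then have "real (T n) \<le> real n" using T(1) unfolding left_diff_distrib by linarith
    then have Tn: "T n \<le> n" by simp
    have "2 ^ j < real n / b" using j(1) assms(4) by (simp add: pos_less_divide_eq)
    also have "\<dots> = real n - 2 * (\<eta> * real n)" by (simp add: \<eta>_def left_diff_distrib diff_divide_distrib)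
    finally have j': "2 ^ j < real n - 2 * (\<eta> * real n)" .
    have "real n * (1 / 2) ^ d \<le> real n * (\<eta> / 4)" using d by (intro mult_left_mono) auto
    then have "real n * (1 / 2) ^ d \<le> \<eta> * real n / 4" by (simp add: mult.commute)
    \<comment> \<open>This is \<open>late\<close> divided by \<open>2 ^ d\<close>.\<close>
    then have "2 ^ j + 2 * (real n * (1 / 2) ^ d) < 2 * real (T n)"
      using j' T(2) n4 unfolding left_diff_distrib \<epsilon>_def by simp
    then have "(2 ^ j + 2 * (real n * (1 / 2) ^ d)) * 2 ^ d < 2 * real (T n) * 2 ^ d"
      by (intro mult_strict_right_mono) auto
    then have "real (2 ^ j * 2 ^ d + 2 * n) < real (2 * T n * 2 ^ d)"
      by (simp add: power_one_over distrib_right)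
    then have late: "2 ^ j * 2 ^ d + 2 * n < 2 * T n * 2 ^ d" by (simp only: of_nat_less_iff)
    define bad where "bad = {\<pi>. \<exists>a>A n. majority (\<pi> ` {1..T n}) a}"
    \<comment> \<open>All randomness sits in \<open>bad\<close>; outside it the bound is
      deterministic.\<close>
    have good: "\<pi> \<in> ?good n" if \<pi>: "\<pi> permutes {1..n}" and "\<pi> \<notin> bad" for \<pi>
    proof -
      have fst_xs: "map fst (?xs n \<pi>) = map \<pi> [1..<Suc n]" by (simp add: o_def)
      have set: "set [1..<Suc n] = {1..n}" by auto
      have dist: "distinct (map fst (?xs n \<pi>))"
        unfolding fst_xs distinct_map set using permutes_inj_on[OF \<pi>] by simp
      have keys: "fst ` set (?xs n \<pi>) \<subseteq> {1..n}"
        unfolding set_map[symmetric] fst_xs unfolding set_map set using permutes_image[OF \<pi>] by simp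
      have "take (T n) (?xs n \<pi>) = ?xs (T n) \<pi>" using Tn by (simp add: take_map del: upt_Suc)
      then have "fst ` set (take (T n) (?xs n \<pi>)) = \<pi> ` {1..T n}"
        by (simp add: image_image atLeastLessThanSuc_atLeastAtMost del: upt_Suc)
      then have "a \<le> A n" if "majority (fst ` set (take (T n) (?xs n \<pi>))) a" for a
        using that \<open>\<pi> \<notin> bad\<close> by (auto simp: bad_def not_less[symmetric] simp del: upt_Suc)
      then have "insertion_calls h (?xs n \<pi>) \<le> n * (3 * A n + 3 * d + 14)"
        by (intro insertion_calls_le[where h = h, OF assms(6) j(2) late dist keys])
      then have "real (insertion_calls h (?xs n \<pi>)) \<le> real (n * (3 * A n + 3 * d + 14))"
        by (rule of_nat_mono)
      also have "\<dots> = real n * (3 * real (A n) + (3 * real d + 14))" by simp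
      also have "\<dots> \<le> real n * (3 * g n + (3 * real d + 14) * g n)"
      proof (intro mult_left_mono add_mono)
        show "real (A n) \<le> g n" unfolding A_def using g1 by linarith
        show "3 * real d + 14 \<le> (3 * real d + 14) * g n"
          using mult_left_mono[OF g1, of "3 * real d + 14"] by simp
      qed simp_all
      also have "\<dots> = C * (real n * g n)" by (simp add: C_def algebra_simps)
      finally show ?thesis by (simp only: mem_Collect_eq)
    qed
    have fin: "finite {\<pi>. \<pi> permutes {1..n}}" by (rule finite_permutations) simp
    have ne: "{\<pi>. \<pi> permutes {1..n}} \<noteq> {}" using permutes_id by blast
    have "?p n bad \<le> 1 / \<epsilon>\<^sup>2 * (1 / 2) ^ A n"
      unfolding bad_def using n0 T(1) \<eta> by (intro prob_large_majority_le) (auto simp: \<epsilon>_def)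
    then have "1 - 1 / \<epsilon>\<^sup>2 * (1 / 2) ^ A n \<le> ?p n (- bad)"
      using measure_pmf.prob_compl[of bad "pmf_of_set {\<pi>. \<pi> permutes {1..n}}"]
      by (simp add: Compl_eq_Diff_UNIV)
    \<comment> \<open>\<open>good\<close> speaks about permutations of \<open>{1..n}\<close> only,
      so the inclusion is used on the support of the distribution.\<close>
    also have "\<dots> \<le> ?p n (?good n)"
      using good fin ne
      by (intro measure_pmf.finite_measure_mono_AE) (simp_all add: AE_measure_pmf_iff)
    finally show ?thesis .
  qed
  have A: "filterlim A at_top sequentially"
    unfolding A_def
    by (rule filterlim_compose[OF filterlim_nat_sequentially
          filterlim_compose[OF filterlim_floor_sequentially assms(2)]])
  have "(\<lambda>n. 1 - 1 / \<epsilon>\<^sup>2 * (1 / 2) ^ A n) \<longlonglongrightarrow> 1 - 1 / \<epsilon>\<^sup>2 * 0"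
    by (intro tendsto_intros filterlim_compose[OF LIMSEQ_power_zero A]) simp
  then have lim: "((\<lambda>n. 1 - 1 / \<epsilon>\<^sup>2 * (1 / 2) ^ A n) \<longlongrightarrow> 1) (inf sequentially (principal (N_set b)))"
    by (intro tendsto_mono[OF inf_le1]) simp
  have "eventually (\<lambda>n. g n \<ge> 1) sequentially"
    using assms(2) by (simp add: filterlim_at_top)
  moreover have "eventually (\<lambda>n. real n \<ge> 4 / \<eta>) sequentially"
    using filterlim_real_sequentially by (simp add: filterlim_at_top)
  ultimately have ev: "eventually (\<lambda>n. 1 - 1 / \<epsilon>\<^sup>2 * (1 / 2) ^ A n \<le> ?p n (?good n))
      (inf sequentially (principal (N_set b)))"
    \<comment> \<open>The principal filter supplies \<open>n \<in> N_set b\<close> for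
      \<open>lower\<close>.\<close>
    unfolding eventually_inf_principal by eventually_elim (use lower in blast)
  have "((\<lambda>n. ?p n (?good n)) \<longlongrightarrow> 1) (inf sequentially (principal (N_set b)))"
    by (rule tendsto_sandwich[OF ev _ lim tendsto_const]) simp
  moreover have "C > 0" by (simp add: C_def)
  ultimately show ?thesis by blast
qed

end
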